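(* Let $N\ge1$ be an integer, let $q$ be a primitive $N$-th root of unity (for instance $q=e^{2\pi i/N}$), and let $\alpha,\beta$ be real numbers with $\alpha>-1$, $\beta>-1$. Let $L(N)$ be the Dunkl-type operator defined in the context and put $$H(N)=L(N)^2-N(\alpha+\beta+1)L(N),\qquad \tilde H(N)=\phi(z)^{-1}H(N)\,\phi(z),\qquad \phi(z)=z-z^{-1},$$ where $\phi(z)^{\pm1}$ act by multiplication. Let $\Lambda_n(N)=n\bigl(n+N(\alpha+\beta+1)\bigr)$ and $x(z)=z+z^{-1}$. Then the sieved Jacobi polynomials of the first kind $P_n(x;N)$ and of the second kind $Q_n(x;N)$ satisfy, for all $n=0,1,2,\dots$, $$H(N)\,P_n(x(z);N)=\Lambda_n(N)\,P_n(x(z);N)$$ and $$\tilde H(N)\,Q_n(x(z);N)=\Lambda_{n+1}(N)\,Q_n(x(z);N).$$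
   Context: The operator $L(N)$ acts on functions of $z$ by $L(N)=z\partial_z+\sum_{k=0}^{N-1}A_k(z;N)(R_k-\mathcal I)$, where $R_kf(z)=f(q^k/z)$, $\mathcal I$ is the identity, and for $k=0,\dots,N-1$: if $N$ is even, $$A_k(z;N)=\bigl(\alpha+\beta+1+(-1)^k(\alpha-\beta)\bigr)\frac{z^2}{q^k-z^2};$$ if $N$ is odd, $$A_k(z;N)=\frac{(\alpha+\beta+1)z^2+\rho_k(\alpha-\beta)z}{q^k-z^2},\quad \rho_k=q^{k/2}\ (k\text{ even}),\quad \rho_k=q^{(k-N)/2}\ (k\text{ odd}).$$ Jacobi Verblunsky parameters: $a_n=-\dfrac{\alpha+1/2+(-1)^{n+1}(\beta+1/2)}{n+\alpha+\beta+2}$, $n=0,1,2,\dots$. Sieved Verblunsky parameters: $a_n(N)=a_{k-1}$ if $n=Nk-1$ for some integer $k\ge1$, and $a_n(N)=0$ otherwise. The sieved Jacobi polynomials on the unit circle are defined by $\Phi_0(z;N)=1$, $\Phi_{n+1}(z;N)=z\Phi_n(z;N)-a_n(N)\,z^n\Phi_n(1/z;N)$. The sieved Jacobi polynomials on the real line of the first and second kind are the monic polynomials $P_n(x;N)$, $Q_n(x;N)$ of degree $n$ in $x$ determined by $P_0=1$, $$P_n(z+z^{-1};N)=z^{1-n}\Phi_{2n-1}(z;N)+z^{n-1}\Phi_{2n-1}(1/z;N)\quad(n\ge1),$$ $$Q_n(z+z^{-1};N)=\frac{z^{-n}\Phi_{2n+1}(z;N)-z^{n}\Phi_{2n+1}(1/z;N)}{z-z^{-1}}\quad(n\ge0).$$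 *)

theory Defs
  imports "HOL-Analysis.Analysis" "HOL-Computational_Algebra.Computational_Algebra"
begin

definition primitive_root_of_unity :: "nat \<Rightarrow> complex \<Rightarrow> bool" where
  "primitive_root_of_unity N q \<longleftrightarrow> q ^ N = 1 \<and> (\<forall>k. 0 < k \<and> k < N \<longrightarrow> q ^ k \<noteq> 1)"

section \<open>The Dunkl-type operators\<close>

definition refl_op :: "complex \<Rightarrow> nat \<Rightarrow> (complex \<Rightarrow> complex) \<Rightarrow> complex \<Rightarrow> complex" where
  "refl_op q k f z = f (q ^ k / z)"

text \<open>Only used for odd \<open>N\<close>; then the exponents \<open>k/2\<close> (\<open>k\<close> even) and \<open>(k - N)/2\<close>
  (\<open>k\<close> odd) are integers and no choice of a square root of \<open>q\<close> is involved.\<close>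

definition rho :: "nat \<Rightarrow> complex \<Rightarrow> nat \<Rightarrow> complex" where
  "rho N q k = (if even k then q powi (int k div 2) else q powi ((int k - int N) div 2))"

definition A_coeff :: "nat \<Rightarrow> complex \<Rightarrow> real \<Rightarrow> real \<Rightarrow> nat \<Rightarrow> complex \<Rightarrow> complex" where
  "A_coeff N q \<alpha> \<beta> k z =
     (if even N
      then of_real (\<alpha> + \<beta> + 1 + (-1) ^ k * (\<alpha> - \<beta>)) * (z\<^sup>2 / (q ^ k - z\<^sup>2))
      else (of_real (\<alpha> + \<beta> + 1) * z\<^sup>2 + rho N q k * of_real (\<alpha> - \<beta>) * z) / (q ^ k - z\<^sup>2))"

definition L_op :: "nat \<Rightarrow> complex \<Rightarrow> real \<Rightarrow> real \<Rightarrow> (complex \<Rightarrow> complex) \<Rightarrow> complex \<Rightarrow> complex" where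
  "L_op N q \<alpha> \<beta> f z =
     z * deriv f z + (\<Sum>k<N. A_coeff N q \<alpha> \<beta> k z * (refl_op q k f z - f z))"

definition H_op :: "nat \<Rightarrow> complex \<Rightarrow> real \<Rightarrow> real \<Rightarrow> (complex \<Rightarrow> complex) \<Rightarrow> complex \<Rightarrow> complex" where
  "H_op N q \<alpha> \<beta> f z =
     L_op N q \<alpha> \<beta> (L_op N q \<alpha> \<beta> f) z - of_nat N * of_real (\<alpha> + \<beta> + 1) * L_op N q \<alpha> \<beta> f z"

definition phi :: "complex \<Rightarrow> complex" where
  "phi z = z - inverse z"

definition H_tilde_op :: "nat \<Rightarrow> complex \<Rightarrow> real \<Rightarrow> real \<Rightarrow> (complex \<Rightarrow> complex) \<Rightarrow> complex \<Rightarrow> complex" where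
  "H_tilde_op N q \<alpha> \<beta> f z = inverse (phi z) * H_op N q \<alpha> \<beta> (\<lambda>w. phi w * f w) z"

text \<open>The coefficients of the operators can have poles only at the zeros of \<open>q\<^sup>k - z\<^sup>2\<close>
  (\<open>k < N\<close>), and \<open>z = 0\<close> has no reflected point. The complement of all these points is open
  and invariant under the maps \<open>z \<mapsto> q\<^sup>k / z\<close>, so on it the operators and their compositions can be
  evaluated pointwise. Since \<open>phi z = 0\<close> means \<open>z\<^sup>2 = q\<^sup>0\<close>, the conjugation by
  \<open>phi\<close> is covered as well.\<close>

definition regular_points :: "nat \<Rightarrow> complex \<Rightarrow> complex set" where
  "regular_points N q = {z. z \<noteq> 0 \<and> (\<forall>k<N. z\<^sup>2 \<noteq> q ^ k)}"

definition Lambda :: "nat \<Rightarrow> real \<Rightarrow> real \<Rightarrow> nat \<Rightarrow> real" where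
  "Lambda N \<alpha> \<beta> n = real n * (real n + real N * (\<alpha> + \<beta> + 1))"

section \<open>Sieved Jacobi polynomials\<close>

definition jacobi_verblunsky :: "real \<Rightarrow> real \<Rightarrow> nat \<Rightarrow> real" where
  "jacobi_verblunsky \<alpha> \<beta> n =
     - ((\<alpha> + 1/2 + (-1) ^ (n + 1) * (\<beta> + 1/2)) / (real n + \<alpha> + \<beta> + 2))"

definition sieved_verblunsky :: "nat \<Rightarrow> real \<Rightarrow> real \<Rightarrow> nat \<Rightarrow> real" where
  "sieved_verblunsky N \<alpha> \<beta> n =
     (if N dvd n + 1 then jacobi_verblunsky \<alpha> \<beta> ((n + 1) div N - 1) else 0)"

text \<open>\<open>reflect_poly\<close> reverses the coefficients of \<open>\<Phi>\<^sub>n\<close>, that is, it yields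
  \<open>z\<^sup>n \<Phi>\<^sub>n(1/z)\<close> because \<open>\<Phi>\<^sub>n\<close> has degree \<open>n\<close>; see the lemmas below.\<close>

primrec sieved_opuc :: "nat \<Rightarrow> real \<Rightarrow> real \<Rightarrow> nat \<Rightarrow> complex poly" where
  "sieved_opuc N \<alpha> \<beta> 0 = 1"
| "sieved_opuc N \<alpha> \<beta> (Suc n) =
     monom 1 1 * sieved_opuc N \<alpha> \<beta> n
     - smult (of_real (sieved_verblunsky N \<alpha> \<beta> n)) (reflect_poly (sieved_opuc N \<alpha> \<beta> n))"

lemma sieved_opuc_monic:
  "degree (sieved_opuc N \<alpha> \<beta> n) = n \<and> lead_coeff (sieved_opuc N \<alpha> \<beta> n) = 1"
proof (induction n)
  case 0
  show ?case by simp
next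
  case (Suc n)
  let ?p = "sieved_opuc N \<alpha> \<beta> n"
  let ?r = "smult (of_real (sieved_verblunsky N \<alpha> \<beta> n)) (reflect_poly ?p)"
  have lt: "degree ?r < Suc n"
    using Suc degree_reflect_poly_le[of ?p] degree_smult_le le_trans less_Suc_eq_le by metis
  have eq: "sieved_opuc N \<alpha> \<beta> (Suc n) = pCons 0 ?p - ?r"
    by (simp add: monom_altdef)
  have "coeff ?p n = 1" using Suc by metis
  then have c: "coeff (pCons 0 ?p - ?r) (Suc n) = 1"
    by (simp only: coeff_diff coeff_pCons_Suc coeff_eq_0[OF lt] diff_zero)
  have "degree (pCons 0 ?p - ?r) \<le> Suc n"
    using Suc lt by (intro degree_diff_le) (auto intro: order_trans[OF degree_pCons_le])
  moreover have "Suc n \<le> degree (pCons 0 ?p - ?r)"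
    using c by (intro le_degree) simp
  ultimately show ?case using c eq by (simp only:) auto
qed

lemma poly_sieved_opuc_Suc:
  assumes "z \<noteq> 0"
  shows "poly (sieved_opuc N \<alpha> \<beta> (Suc n)) z =
           z * poly (sieved_opuc N \<alpha> \<beta> n) z
           - of_real (sieved_verblunsky N \<alpha> \<beta> n) * z ^ n * poly (sieved_opuc N \<alpha> \<beta> n) (inverse z)"
  using assms sieved_opuc_monic[of N \<alpha> \<beta> n]
  by (simp add: poly_monom poly_reflect_poly_nz algebra_simps)

definition sieved_jacobi_P :: "nat \<Rightarrow> real \<Rightarrow> real \<Rightarrow> nat \<Rightarrow> complex poly" where
  "sieved_jacobi_P N \<alpha> \<beta> n =
     (if n = 0 then 1
      else THE p. degree p = n \<and> lead_coeff p = 1 \<and>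
        (\<forall>z. z \<noteq> 0 \<longrightarrow>
          poly p (z + inverse z) =
            z powi (1 - int n) * poly (sieved_opuc N \<alpha> \<beta> (2 * n - 1)) z
            + z powi (int n - 1) * poly (sieved_opuc N \<alpha> \<beta> (2 * n - 1)) (inverse z)))"

definition sieved_jacobi_Q :: "nat \<Rightarrow> real \<Rightarrow> real \<Rightarrow> nat \<Rightarrow> complex poly" where
  "sieved_jacobi_Q N \<alpha> \<beta> n =
     (THE p. degree p = n \<and> lead_coeff p = 1 \<and>
        (\<forall>z. z \<noteq> 0 \<and> z - inverse z \<noteq> 0 \<longrightarrow>
          poly p (z + inverse z) =
            (z powi (- int n) * poly (sieved_opuc N \<alpha> \<beta> (2 * n + 1)) z
             - z powi (int n) * poly (sieved_opuc N \<alpha> \<beta> (2 * n + 1)) (inverse z))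
            / (z - inverse z)))"

end

theory Submission
  imports Defs
begin

text \<open>
  Write \<open>c = \<alpha> + \<beta> + 1\<close>, \<open>d = \<alpha> - \<beta>\<close>, and let \<open>R f(z) = f(1/z)\<close>. The Laurent polynomials
  \<open>u\<^sub>n(z) = z\<^sup>n \<Phi>\<^sub>2\<^sub>n(1/z)\<close> and \<open>v\<^sub>n(z) = z\<^sup>-\<^sup>n \<Phi>\<^sub>2\<^sub>n\<^sub>+\<^sub>1(z)\<close>, which form the CMV basis, are
  eigenfunctions of \<open>L\<close> itself: \<open>L u\<^sub>n = -n u\<^sub>n\<close> and \<open>L v\<^sub>n = (n + 1 + N c) v\<^sub>n\<close>
  (lemmas \<open>L_op_cmv_even\<close> and \<open>L_op_cmv_odd\<close>). The polynomial \<open>\<lambda>\<^sup>2 - N c \<lambda>\<close> takes the same value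
  \<open>\<Lambda>\<^sub>n\<^sub>+\<^sub>1\<close> at the eigenvalues of \<open>v\<^sub>n\<close> and \<open>u\<^sub>n\<^sub>+\<^sub>1\<close>, so \<open>H\<close> acts as a scalar on their span. By
  the Szego recurrence this span contains \<open>R v\<^sub>n\<close>, hence also
  \<open>v\<^sub>n + R v\<^sub>n = P\<^sub>n\<^sub>+\<^sub>1(z + 1/z)\<close> and \<open>v\<^sub>n - R v\<^sub>n = (z - 1/z) Q\<^sub>n(z + 1/z)\<close>.

  The eigenvalue equations for \<open>L\<close> follow by induction along the chain
  \<open>u\<^sub>0, v\<^sub>0, u\<^sub>1, v\<^sub>1, \<dots>\<close>, in which
  \<open>v\<^sub>n = z R u\<^sub>n - a\<^sub>2\<^sub>n u\<^sub>n\<close> and \<open>u\<^sub>n\<^sub>+\<^sub>1 = R v\<^sub>n - a\<^sub>2\<^sub>n\<^sub>+\<^sub>1 v\<^sub>n\<close>. Moving \<open>L\<close> past \<open>R\<close> and past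
  multiplication by \<open>z\<close> cancels every denominator \<open>q\<^sup>k - z\<^sup>2\<close> and leaves only weighted sums of the
  rotated values \<open>f(z/q\<^sup>k)\<close> (lemmas \<open>L_op_reflect\<close> and \<open>L_op_mult_reflect\<close>).

  Sieving makes \<open>\<Phi>\<^sub>n\<close> homogeneous under rotation: \<open>\<Phi>\<^sub>n(q z) = q\<^sup>n \<Phi>\<^sub>n(z)\<close>, because \<open>a\<^sub>n\<close> vanishes
  unless \<open>q\<^sup>n\<^sup>+\<^sup>1 = 1\<close>. The rotation sums therefore become geometric sums over roots of unity. In the
  step with parameter \<open>a\<^sub>n\<close> the sum vanishes unless \<open>N\<close> divides \<open>n + 1\<close>, as \<open>a\<^sub>n\<close> does, and it always
  equals the required multiple \<open>-a\<^sub>n (n + 1 + N c)\<close> of the eigenfunction (lemmas \<open>sum_D_cmv_even\<close> and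
  \<open>sum_B_cmv_odd\<close>).
\<close>

section \<open>Inversion, roots of unity and Verblunsky parameters\<close>

lemma has_field_derivative_reflect:
  fixes f :: "complex \<Rightarrow> complex"
  assumes "z \<noteq> 0" "f field_differentiable at (inverse z)"
  shows "((\<lambda>w. f (inverse w)) has_field_derivative (- deriv f (inverse z) / z\<^sup>2)) (at z)"
proof -
  have "(f has_field_derivative deriv f (inverse z)) (at (inverse z))"
    using assms(2) by (simp add: DERIV_deriv_iff_field_differentiable)
  from DERIV_chain2[OF this DERIV_inverse[OF assms(1)]]
  show ?thesis by (rule DERIV_cong) (simp add: divide_inverse power_inverse numeral_2_eq_2)
qed

lemma field_differentiable_reflect:
  fixes f :: "complex \<Rightarrow> complex"
  assumes "z \<noteq> 0" "f field_differentiable at (inverse z)"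
  shows "(\<lambda>w. f (inverse w)) field_differentiable at z"
  using has_field_derivative_reflect[OF assms] unfolding field_differentiable_def by blast

lemma root_of_unity_power_mod:
  assumes "primitive_root_of_unity N q"
  shows "q ^ (k mod N) = q ^ k"
proof -
  have "q ^ k = q ^ (N * (k div N) + k mod N)" by simp
  also have "\<dots> = q ^ (k mod N)"
    using assms unfolding primitive_root_of_unity_def power_add power_mult by simp
  finally show ?thesis by simp
qed

lemma root_of_unity_power_power:
  assumes "primitive_root_of_unity N q"
  shows "(q ^ j) ^ N = 1"
proof -
  have "(q ^ j) ^ N = (q ^ N) ^ j" by (metis power_mult mult.commute)
  then show ?thesis using assms by (simp add: primitive_root_of_unity_def)
qed

lemma root_of_unity_power_eq_1_iff:
  assumes "primitive_root_of_unity N q" "N \<ge> 1"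
  shows "q ^ k = 1 \<longleftrightarrow> N dvd k"
proof
  assume "q ^ k = 1"
  then have "q ^ (k mod N) = 1" using root_of_unity_power_mod[OF assms(1)] by simp
  moreover have "k mod N < N" using assms(2) by simp
  ultimately have "k mod N = 0"
    using assms(1) unfolding primitive_root_of_unity_def by (metis neq0_conv)
  then show "N dvd k" by (rule mod_0_imp_dvd)
next
  assume "N dvd k"
  then obtain j where "k = N * j" ..
  then show "q ^ k = 1"
    using assms(1) by (simp add: primitive_root_of_unity_def power_mult)
qed

lemma root_of_unity_nonzero:
  assumes "primitive_root_of_unity N q" "N \<ge> 1"
  shows "q \<noteq> 0"
proof
  assume "q = 0"
  then have "q ^ N = 0" using assms(2) by simp
  moreover have "q ^ N = 1" using assms(1) by (simp add: primitive_root_of_unity_def)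
  ultimately show False by simp
qed

lemma root_of_unity_power_half:
  assumes "primitive_root_of_unity N q" "N \<ge> 1" "even N"
  shows "q ^ (N div 2) = -1"
proof -
  have "(q ^ (N div 2))\<^sup>2 = q ^ (N div 2 * 2)" by (rule power_mult[symmetric])
  also have "\<dots> = 1"
    using assms(1,3) by (simp add: primitive_root_of_unity_def)
  finally have "(q ^ (N div 2))\<^sup>2 = 1" .
  moreover have "\<not> N dvd N div 2" using assms(2,3) by (auto dest: dvd_imp_le)
  then have "q ^ (N div 2) \<noteq> 1"
    unfolding root_of_unity_power_eq_1_iff[OF assms(1,2)] .
  ultimately show ?thesis by (simp add: power2_eq_1_iff)
qed

lemma sum_powers_root_of_unity:
  fixes w :: complex
  assumes "w ^ N = 1"
  shows "(\<Sum>k<N. w ^ k) = (if w = 1 then of_nat N else 0)"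
  using assms by (simp add: geometric_sum)

text \<open>For odd \<open>N\<close> the number \<open>h = q\<^bsup>(N + 1) / 2\<^esup>\<close> is a square root of \<open>q\<close> inside the group of \<open>N\<close>-th
  roots of unity. In terms of \<open>h\<close> the case distinction on the parity of \<open>k\<close> disappears, and sums
  against \<open>\<rho>\<^sub>k\<close> become geometric.\<close>

lemma rho_eq_power:
  assumes "primitive_root_of_unity N q" "N \<ge> 1" "odd N"
  shows "rho N q k = (q ^ ((N + 1) div 2)) ^ k"
proof (cases "even k")
  case True
  then obtain j where j: "k = 2 * j" by auto
  have "(q ^ ((N + 1) div 2)) ^ k = q ^ ((N + 1) div 2 * 2 * j)"
    unfolding j power_mult[symmetric] by (simp add: mult_ac)
  also have "(N + 1) div 2 * 2 = N + 1" using assms(3) by presburger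
  also have "q ^ ((N + 1) * j) = q ^ j"
    using assms(1) unfolding primitive_root_of_unity_def power_mult by simp
  finally show ?thesis by (simp add: rho_def j power_int_def)
next
  case False
  then obtain j where j: "k = 2 * j + 1" using oddE by blast
  from assms(3) obtain m where m: "N = 2 * m + 1" using oddE by blast
  have q0: "q \<noteq> 0" using root_of_unity_nonzero assms by blast
  have e: "(int k - int N) div 2 = int j - int m" by (simp add: j m)
  have qN: "q ^ N = 1" using assms(1) unfolding primitive_root_of_unity_def by simp
  have h: "(N + 1) div 2 = Suc m" by (simp add: m)
  have "(q ^ ((N + 1) div 2)) ^ k * q ^ m = q ^ (Suc m * (2 * j + 1) + m)"
    unfolding h j power_mult[symmetric] power_add[symmetric] ..
  also have "Suc m * (2 * j + 1) + m = N * (j + 1) + j"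
    by (simp add: m algebra_simps)
  also have "q ^ \<dots> = q ^ j" unfolding power_add[of q "N * (j + 1)"] power_mult qN by simp
  finally have "(q ^ ((N + 1) div 2)) ^ k = q ^ j / q ^ m"
    by (rule eq_divide_imp[rotated]) (simp add: q0)
  then show ?thesis using q0 False by (simp add: rho_def e power_int_diff)
qed

text \<open>The factor is the difference of the two eigenvalues of \<open>L\<close> that the step with parameter \<open>a\<^sub>n\<close>
  connects. It cancels the denominator of \<open>a\<^sub>n\<close>.\<close>

lemma sieved_verblunsky_times:
  assumes "N \<ge> 1" "\<alpha> > -1" "\<beta> > -1"
  shows "sieved_verblunsky N \<alpha> \<beta> n * (real n + 1 + real N * (\<alpha> + \<beta> + 1)) =
    - (if N dvd n + 1 then real N * (if even ((n + 1) div N) then \<alpha> + \<beta> + 1 else \<alpha> - \<beta>) else 0)"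
proof (cases "N dvd n + 1")
  case True
  then obtain j where j: "n + 1 = N * j" by auto
  have j1: "j \<ge> 1" using j by (cases j) auto
  have "real (n + 1) = real (N * j)" by (simp only: j)
  then have n: "real n + 1 = real N * real j" by (simp only: of_nat_add of_nat_mult of_nat_1)
  have "real n + 1 + real N * (\<alpha> + \<beta> + 1) = real N * (real j + \<alpha> + \<beta> + 1)"
    by (simp only: n) (simp add: algebra_simps)
  moreover have "real j + \<alpha> + \<beta> + 1 \<noteq> 0" using j1 assms by linarith
  moreover have "(n + 1) div N = j" using j assms(1) by simp
  moreover have "sieved_verblunsky N \<alpha> \<beta> n =
      - ((if even j then \<alpha> + \<beta> + 1 else \<alpha> - \<beta>) / (real j + \<alpha> + \<beta> + 1))"
  proof -
    have "real (j - 1) = real j - 1" using j1 by simp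
    then show ?thesis using True j1 \<open>(n + 1) div N = j\<close>
      by (simp add: sieved_verblunsky_def jacobi_verblunsky_def algebra_simps)
  qed
  ultimately show ?thesis using True by simp
next
  case False
  then show ?thesis by (simp add: sieved_verblunsky_def)
qed

text \<open>The two terms of the recurrence for \<open>\<Phi>\<^sub>n\<^sub>+\<^sub>1\<close> pick up the factors \<open>q\<^sup>n\<^sup>+\<^sup>1\<close> and \<open>1\<close> under the rotation
  \<open>z \<mapsto> q z\<close>. These agree whenever the second term is present.\<close>

lemma sieved_opuc_homogeneous:
  assumes "primitive_root_of_unity N q" "N \<ge> 1" "z \<noteq> 0"
  shows "poly (sieved_opuc N \<alpha> \<beta> n) (q * z) = q ^ n * poly (sieved_opuc N \<alpha> \<beta> n) z"
  using assms(3)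
proof (induction n arbitrary: z)
  case 0
  show ?case by simp
next
  case (Suc n)
  have q0: "q \<noteq> 0" using root_of_unity_nonzero assms by blast
  have "poly (sieved_opuc N \<alpha> \<beta> n) (inverse z) =
        poly (sieved_opuc N \<alpha> \<beta> n) (q * inverse (q * z))"
    using q0 Suc.prems by (simp add: field_simps)
  also have "\<dots> = q ^ n * poly (sieved_opuc N \<alpha> \<beta> n) (inverse (q * z))"
    using q0 Suc.prems by (intro Suc.IH) simp
  finally have r: "poly (sieved_opuc N \<alpha> \<beta> n) (inverse z) =
    q ^ n * poly (sieved_opuc N \<alpha> \<beta> n) (inverse (q * z))" .
  have a: "sieved_verblunsky N \<alpha> \<beta> n = 0 \<or> q * q ^ n = 1"
    using root_of_unity_power_eq_1_iff[OF assms(1,2), of "Suc n"]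
    by (auto simp: sieved_verblunsky_def)
  have "poly (sieved_opuc N \<alpha> \<beta> (Suc n)) (q * z)
      = q * z * (q ^ n * poly (sieved_opuc N \<alpha> \<beta> n) z)
        - of_real (sieved_verblunsky N \<alpha> \<beta> n) * z ^ n * poly (sieved_opuc N \<alpha> \<beta> n) (inverse z)"
    using q0 Suc.prems
    by (subst poly_sieved_opuc_Suc) (simp_all add: Suc.IH r power_mult_distrib del: sieved_opuc.simps)
  also have "\<dots> = q ^ Suc n * poly (sieved_opuc N \<alpha> \<beta> (Suc n)) z"
    using a
  proof
    assume "q * q ^ n = 1"
    then show ?thesis by (simp add: poly_sieved_opuc_Suc[OF Suc.prems] del: sieved_opuc.simps)
  qed (simp add: poly_sieved_opuc_Suc[OF Suc.prems] del: sieved_opuc.simps)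
  finally show ?case .
qed

section \<open>Locality and linearity\<close>

lemma regular_pointsD:
  assumes "primitive_root_of_unity N q" "N \<ge> 1" "z \<in> regular_points N q"
  shows "z \<noteq> 0" "z\<^sup>2 \<noteq> q ^ k"
proof -
  show "z \<noteq> 0" using assms(3) unfolding regular_points_def by simp
  have "k mod N < N" using assms(2) by simp
  then show "z\<^sup>2 \<noteq> q ^ k"
    using assms(3) unfolding root_of_unity_power_mod[OF assms(1), of k, symmetric] regular_points_def
    by simp
qed

lemma open_regular_points: "open (regular_points N q)"
proof -
  have "regular_points N q = {z. z \<noteq> 0} \<inter> (\<Inter>k\<in>{..<N}. {z. z\<^sup>2 \<noteq> q ^ k})"
    unfolding regular_points_def by auto
  also have "open \<dots>"
    by (intro open_Int open_INT ballI open_Collect_neq continuous_intros) auto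
  finally show ?thesis .
qed

lemma reflection_regular_points:
  assumes "primitive_root_of_unity N q" "N \<ge> 1" "z \<in> regular_points N q" "k \<le> N"
  shows "q ^ k / z \<in> regular_points N q"
proof -
  note z = regular_pointsD[OF assms(1-3)]
  have q0: "q \<noteq> 0" using root_of_unity_nonzero assms by blast
  have qN: "q ^ N = 1" using assms(1) unfolding primitive_root_of_unity_def by simp
  have "(q ^ k / z)\<^sup>2 \<noteq> q ^ j" if "j < N" for j
  proof
    assume "(q ^ k / z)\<^sup>2 = q ^ j"
    then have e: "z\<^sup>2 * q ^ j = q ^ (2 * k)"
      using z(1) by (simp add: field_simps power_mult power2_eq_square power_add flip: mult_2)
    have "z\<^sup>2 = z\<^sup>2 * q ^ j * q ^ (N - j)"
      using that qN by (simp add: mult.assoc flip: power_add)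
    also have "\<dots> = q ^ (2 * k + (N - j))" by (simp add: e power_add)
    finally show False using z(2) by blast
  qed
  then show ?thesis using z(1) q0 by (simp add: regular_points_def)
qed

text \<open>The eigenvalue equations hold on the regular points only, while \<open>L\<close> differentiates and reflects
  its argument. Since the set of regular points is open and stable under reflections, such equations
  may be substituted under \<open>L\<close>.\<close>

lemma L_op_cong:
  assumes "primitive_root_of_unity N q" "N \<ge> 1" "z \<in> regular_points N q"
    and eq: "\<And>w. w \<in> regular_points N q \<Longrightarrow> f w = g w"
  shows "L_op N q \<alpha> \<beta> f z = L_op N q \<alpha> \<beta> g z"
proof -
  have "\<forall>\<^sub>F w in nhds z. f w = g w"
    using eventually_nhds_in_open[OF open_regular_points assms(3)] by eventually_elim (rule eq)
  then have "deriv f z = deriv g z" by (rule deriv_cong_ev) simp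
  then show ?thesis unfolding L_op_def refl_op_def
    using assms reflection_regular_points[OF assms(1-3)] by (simp add: eq)
qed

lemma H_op_cong:
  assumes "primitive_root_of_unity N q" "N \<ge> 1" "z \<in> regular_points N q"
    and eq: "\<And>w. w \<in> regular_points N q \<Longrightarrow> f w = g w"
  shows "H_op N q \<alpha> \<beta> f z = H_op N q \<alpha> \<beta> g z"
proof -
  have L: "L_op N q \<alpha> \<beta> f w = L_op N q \<alpha> \<beta> g w" if "w \<in> regular_points N q" for w
    using L_op_cong[OF assms(1,2) that eq] .
  show ?thesis unfolding H_op_def using L_op_cong[OF assms(1-3) L] L[OF assms(3)] by simp
qed

lemma L_op_linear:
  assumes "f field_differentiable at z" "g field_differentiable at z"
  shows "L_op N q \<alpha> \<beta> (\<lambda>w. a * f w + b * g w) z = a * L_op N q \<alpha> \<beta> f z + b * L_op N q \<alpha> \<beta> g z"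
proof -
  have "((\<lambda>w. a * f w + b * g w) has_field_derivative a * deriv f z + b * deriv g z) (at z)"
    using assms[unfolded DERIV_deriv_iff_field_differentiable[symmetric]]
    by (auto intro!: derivative_eq_intros)
  then have "deriv (\<lambda>w. a * f w + b * g w) z = a * deriv f z + b * deriv g z"
    by (rule DERIV_imp_deriv)
  then show ?thesis unfolding L_op_def refl_op_def
    by (simp add: algebra_simps sum_distrib_left sum.distrib sum_subtractf)
qed

text \<open>On eigenfunctions of \<open>L\<close> the operator \<open>H\<close> is the quadratic polynomial \<open>\<lambda>\<^sup>2 - N c \<lambda>\<close> in the
  eigenvalue. Two eigenfunctions whose eigenvalues are the two roots of \<open>\<lambda>\<^sup>2 - N c \<lambda> = \<Lambda>\<close> thus span an
  eigenspace of \<open>H\<close>.\<close>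

lemma H_op_eigenvector_sum:
  fixes l m \<Lambda> a b :: complex
  assumes "primitive_root_of_unity N q" "N \<ge> 1" "z \<in> regular_points N q"
    and df: "\<And>w. w \<noteq> 0 \<Longrightarrow> f field_differentiable at w"
    and dg: "\<And>w. w \<noteq> 0 \<Longrightarrow> g field_differentiable at w"
    and Lf: "\<And>w. w \<in> regular_points N q \<Longrightarrow> L_op N q \<alpha> \<beta> f w = l * f w"
    and Lg: "\<And>w. w \<in> regular_points N q \<Longrightarrow> L_op N q \<alpha> \<beta> g w = m * g w"
    and l: "l\<^sup>2 - of_nat N * of_real (\<alpha> + \<beta> + 1) * l = \<Lambda>"
    and m: "m\<^sup>2 - of_nat N * of_real (\<alpha> + \<beta> + 1) * m = \<Lambda>"
  shows "H_op N q \<alpha> \<beta> (\<lambda>w. a * f w + b * g w) z = \<Lambda> * (a * f z + b * g z)"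
proof -
  have L: "L_op N q \<alpha> \<beta> (\<lambda>w. s * f w + t * g w) w = (s * l) * f w + (t * m) * g w"
    if "w \<in> regular_points N q" for w s t
    using L_op_linear[OF df dg] regular_pointsD(1)[OF assms(1,2) that] Lf[OF that] Lg[OF that]
    by simp
  have "L_op N q \<alpha> \<beta> (L_op N q \<alpha> \<beta> (\<lambda>w. a * f w + b * g w)) z =
      L_op N q \<alpha> \<beta> (\<lambda>w. (a * l) * f w + (b * m) * g w) z"
    by (rule L_op_cong[OF assms(1-3) L])
  also have "\<dots> = (a * l * l) * f z + (b * m * m) * g z" using L[OF assms(3)] .
  finally have "H_op N q \<alpha> \<beta> (\<lambda>w. a * f w + b * g w) z =
      (l\<^sup>2 - of_nat N * of_real (\<alpha> + \<beta> + 1) * l) * (a * f z) +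
      (m\<^sup>2 - of_nat N * of_real (\<alpha> + \<beta> + 1) * m) * (b * g z)"
    unfolding H_op_def L[OF assms(3)] by (simp add: algebra_simps power2_eq_square)
  then show ?thesis by (simp only: l m distrib_left)
qed

section \<open>Commuting \<open>L\<close> past the inversion and past multiplication by \<open>z\<close>\<close>

text \<open>The numerator of \<open>A\<^sub>k(z)\<close> is \<open>z (z B\<^sub>k + D\<^sub>k)\<close>: \<open>B\<^sub>k\<close> carries the terms in \<open>z\<^sup>2\<close>, and \<open>D\<^sub>k\<close> the
  terms in \<open>z\<close>, which occur for odd \<open>N\<close> only.\<close>

definition B_coeff :: "nat \<Rightarrow> real \<Rightarrow> real \<Rightarrow> nat \<Rightarrow> complex" where
  "B_coeff N \<alpha> \<beta> k = of_real (\<alpha> + \<beta> + 1 + (if even N then (-1) ^ k * (\<alpha> - \<beta>) else 0))"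

definition D_coeff :: "nat \<Rightarrow> complex \<Rightarrow> real \<Rightarrow> real \<Rightarrow> nat \<Rightarrow> complex" where
  "D_coeff N q \<alpha> \<beta> k = (if even N then 0 else rho N q k * of_real (\<alpha> - \<beta>))"

lemma A_coeff_times:
  assumes "z \<noteq> 0" "z\<^sup>2 \<noteq> q ^ k"
  shows "A_coeff N q \<alpha> \<beta> k z * (q ^ k / z - z) = z * B_coeff N \<alpha> \<beta> k + D_coeff N q \<alpha> \<beta> k"
proof -
  have "q ^ k / z - z = (q ^ k - z\<^sup>2) / z"
    using assms(1) by (simp add: field_simps power2_eq_square)
  moreover have "q ^ k - z\<^sup>2 \<noteq> 0" using assms(2) by simp
  ultimately show ?thesis using assms(1)
    by (simp add: A_coeff_def B_coeff_def D_coeff_def field_simps power2_eq_square)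
qed

text \<open>For odd \<open>N\<close> this is where the particular choice of \<open>\<rho>\<^sub>k\<close> matters: \<open>\<rho>\<^sub>N\<^sub>-\<^sub>k q\<^sup>k = \<rho>\<^sub>k\<close> makes the terms in
  \<open>z\<close> cancel, and what remains is a multiple of \<open>z\<^sup>2 - q\<^sup>k\<close>, which cancels the denominator.\<close>

lemma A_coeff_reflect:
  assumes "primitive_root_of_unity N q" "N \<ge> 1" "z \<noteq> 0" "z\<^sup>2 \<noteq> q ^ k" "k \<le> N"
  shows "A_coeff N q \<alpha> \<beta> k z + A_coeff N q \<alpha> \<beta> (N - k) (inverse z) = - B_coeff N \<alpha> \<beta> k"
proof -
  have q0: "q \<noteq> 0" using root_of_unity_nonzero assms by blast
  have qN: "q ^ N = 1" using assms(1) unfolding primitive_root_of_unity_def by simp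
  define Q where "Q = q ^ k"
  have Q: "Q \<noteq> 0" "Q - z\<^sup>2 \<noteq> 0" using q0 assms(4) by (auto simp: Q_def)
  have Q': "q ^ (N - k) = 1 / Q"
    using qN assms(5) q0 by (simp add: Q_def power_diff)
  have den: "1 / Q - (inverse z)\<^sup>2 = - ((Q - z\<^sup>2) / (Q * z\<^sup>2))"
    using Q assms(3) by (simp add: field_simps power2_eq_square)
  have E: "X / (1 / Q - (inverse z)\<^sup>2) = - (Q * z\<^sup>2 * X / (Q - z\<^sup>2))" for X
    unfolding den by simp
  have z2: "z\<^sup>2 * (inverse z)\<^sup>2 = 1" "z\<^sup>2 * inverse z = z"
    using assms(3) by (simp_all add: power2_eq_square field_simps)
  show ?thesis
  proof (cases "even N")
    case True
    define b :: complex where "b = B_coeff N \<alpha> \<beta> k"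
    have "(-1) ^ (N - k) = ((-1) ^ k :: real)"
      using True assms(5) by (auto simp: minus_one_power_iff)
    then have b: "A_coeff N q \<alpha> \<beta> k z = b * (z\<^sup>2 / (Q - z\<^sup>2))"
      "A_coeff N q \<alpha> \<beta> (N - k) (inverse z) = b * ((inverse z)\<^sup>2 / (1 / Q - (inverse z)\<^sup>2))"
      using True unfolding A_coeff_def Q' b_def B_coeff_def unfolding Q_def by simp_all
    have "Q * z\<^sup>2 * (inverse z)\<^sup>2 = Q" using z2(1) by (simp only: mult.assoc mult_1_right)
    moreover have "b * (z\<^sup>2 / (Q - z\<^sup>2)) + b * - (Q / (Q - z\<^sup>2)) = - b"
      using Q(2) by (simp add: divide_simps) (simp add: algebra_simps)
    ultimately show ?thesis by (simp only: b E b_def)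
  next
    case False
    \<comment> \<open>the square root of \<open>q\<close> with \<open>\<rho>\<^sub>k = h\<^sup>k\<close>\<close>
    define h where "h = q ^ ((N + 1) div 2)"
    have h: "rho N q j = h ^ j" for j using rho_eq_power[OF assms(1,2) False] by (simp add: h_def)
    have hN: "h ^ N = 1" using qN by (simp add: h_def root_of_unity_power_power[OF assms(1)])
    have h2: "h\<^sup>2 = q"
    proof -
      have "(N + 1) div 2 * 2 = N + 1" using False by presburger
      then have "h\<^sup>2 = q ^ (N + 1)" unfolding h_def power_mult[symmetric] by (simp only:)
      then show ?thesis using qN by simp
    qed
    have h0: "h \<noteq> 0" using q0 by (simp add: h_def)
    have "h ^ (N - k) = 1 / h ^ k" using hN assms(5) h0 by (simp add: power_diff)
    moreover have "Q = h ^ k * h ^ k" by (simp add: Q_def power_mult_distrib power2_eq_square flip: h2)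
    ultimately have hh: "rho N q (N - k) = h ^ k / Q"
      using h0 by (simp add: h)
    have num: "Q * z\<^sup>2 * (of_real (\<alpha> + \<beta> + 1) * (inverse z)\<^sup>2
        + h ^ k / Q * of_real (\<alpha> - \<beta>) * inverse z) =
        of_real (\<alpha> + \<beta> + 1) * Q + h ^ k * of_real (\<alpha> - \<beta>) * z"
    proof -
      have "Q * z\<^sup>2 * (u * (inverse z)\<^sup>2 + h ^ k / Q * v * inverse z) =
        u * Q * (z\<^sup>2 * (inverse z)\<^sup>2) + h ^ k * v * (z\<^sup>2 * inverse z)" for u v
        using Q(1) by (simp add: distrib_left)
      then show ?thesis unfolding z2 by simp
    qed
    have "(u * z\<^sup>2 + y) / (Q - z\<^sup>2) + - ((u * Q + y) / (Q - z\<^sup>2)) = - u" for u y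
    proof -
      have "(u * z\<^sup>2 + y) - (u * Q + y) = - u * (Q - z\<^sup>2)" by (simp add: algebra_simps)
      then have "((u * z\<^sup>2 + y) - (u * Q + y)) / (Q - z\<^sup>2) = - u"
        by (simp only: nonzero_mult_div_cancel_right[OF Q(2)])
      then show ?thesis by (simp only: diff_divide_distrib add_uminus_conv_diff)
    qed
    then show ?thesis using False
      unfolding A_coeff_def Q' B_coeff_def hh unfolding Q_def[symmetric] h
      by (simp only: if_False add_0_right num E)
  qed
qed

lemma sum_B_coeff:
  assumes "N \<ge> 1"
  shows "(\<Sum>k<N. B_coeff N \<alpha> \<beta> k) = of_nat N * of_real (\<alpha> + \<beta> + 1)"
proof (cases "even N")
  case True
  have "(\<Sum>k<N. B_coeff N \<alpha> \<beta> k) =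
    (\<Sum>k<N. of_real (\<alpha> + \<beta> + 1)) + of_real (\<alpha> - \<beta>) * (\<Sum>k<N. (-1) ^ k)"
    using True by (simp add: B_coeff_def sum.distrib sum_distrib_left mult.commute)
  also have "(\<Sum>k<N. (-1) ^ k) = (0 :: complex)"
    using True by (subst sum_powers_root_of_unity) auto
  finally show ?thesis by simp
qed (simp add: B_coeff_def)

lemma sum_reindex_minus:
  fixes F :: "nat \<Rightarrow> complex"
  assumes "F N = F 0"
  shows "(\<Sum>k<N. F k) = (\<Sum>k<N. F (N - k))"
proof -
  \<comment> \<open>over \<open>{0..N}\<close> the substitution is a bijection; the extra terms \<open>F 0\<close> and \<open>F N\<close> agree\<close>
  have "(\<Sum>k<N. F (N - k)) + F 0 = (\<Sum>k\<le>N. F (N - k))"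
    by (simp flip: lessThan_Suc_atMost)
  also have "\<dots> = (\<Sum>k\<le>N. F k)" by (rule sum.nat_diff_reindex[of F "Suc N", unfolded lessThan_Suc_atMost, simplified])
  also have "\<dots> = (\<Sum>k<N. F k) + F N" by (simp flip: lessThan_Suc_atMost)
  finally show ?thesis using assms by simp
qed

text \<open>Conjugation with the inversion turns \<open>R\<^sub>k\<close> into \<open>R\<^sub>N\<^sub>-\<^sub>k\<close> and changes the sign of \<open>z \<partial>\<^sub>z\<close>. Adding
  \<open>L\<close> to its conjugate, the derivatives cancel and the coefficients combine to the constants
  \<open>-B\<^sub>k\<close>.\<close>

lemma L_op_reflect:
  assumes "primitive_root_of_unity N q" "N \<ge> 1" "z \<in> regular_points N q"
    and df: "f field_differentiable at (inverse z)"
  shows "L_op N q \<alpha> \<beta> (\<lambda>w. f (inverse w)) z =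
     - L_op N q \<alpha> \<beta> f (inverse z) + of_nat N * of_real (\<alpha> + \<beta> + 1) * f (inverse z)
     - (\<Sum>k<N. B_coeff N \<alpha> \<beta> k * f (z / q ^ k))"
proof -
  note z = regular_pointsD[OF assms(1-3)]
  have q0: "q \<noteq> 0" using root_of_unity_nonzero assms by blast
  have qN: "q ^ N = 1" using assms(1) unfolding primitive_root_of_unity_def by simp
  have "deriv (\<lambda>w. f (inverse w)) z = - deriv f (inverse z) / z\<^sup>2"
    by (rule DERIV_imp_deriv[OF has_field_derivative_reflect[OF z(1) df]])
  then have 1: "L_op N q \<alpha> \<beta> (\<lambda>w. f (inverse w)) z =
      - deriv f (inverse z) / z + (\<Sum>k<N. A_coeff N q \<alpha> \<beta> k z * (f (z / q ^ k) - f (inverse z)))"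
    using z(1) by (simp add: L_op_def refl_op_def power2_eq_square)
  have rN: "rho N q N = rho N q 0" if "odd N"
    by (simp add: rho_eq_power[OF assms(1,2) that] root_of_unity_power_power[OF assms(1)])
  have AN: "A_coeff N q \<alpha> \<beta> N w = A_coeff N q \<alpha> \<beta> 0 w" for w
    using rN by (cases "even N") (simp_all add: A_coeff_def qN)
  have "L_op N q \<alpha> \<beta> f (inverse z) = deriv f (inverse z) / z +
      (\<Sum>k<N. A_coeff N q \<alpha> \<beta> k (inverse z) * (f (q ^ k * z) - f (inverse z)))"
    using z(1) by (simp add: L_op_def refl_op_def field_simps)
  also have "(\<Sum>k<N. A_coeff N q \<alpha> \<beta> k (inverse z) * (f (q ^ k * z) - f (inverse z))) =
      (\<Sum>k<N. A_coeff N q \<alpha> \<beta> (N - k) (inverse z) * (f (q ^ (N - k) * z) - f (inverse z)))"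
    by (rule sum_reindex_minus) (simp add: AN qN)
  also have "\<dots> = (\<Sum>k<N. A_coeff N q \<alpha> \<beta> (N - k) (inverse z) * (f (z / q ^ k) - f (inverse z)))"
    using q0 qN by (intro sum.cong) (auto simp: power_diff)
  finally have "L_op N q \<alpha> \<beta> (\<lambda>w. f (inverse w)) z + L_op N q \<alpha> \<beta> f (inverse z) =
     (\<Sum>k<N. (A_coeff N q \<alpha> \<beta> k z + A_coeff N q \<alpha> \<beta> (N - k) (inverse z)) * (f (z / q ^ k) - f (inverse z)))"
    unfolding 1 by (simp add: distrib_right sum.distrib)
  also have "\<dots> = (\<Sum>k<N. - B_coeff N \<alpha> \<beta> k * (f (z / q ^ k) - f (inverse z)))"
    using A_coeff_reflect[OF assms(1,2) z] by (intro sum.cong) auto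
  also have "\<dots> = (\<Sum>k<N. B_coeff N \<alpha> \<beta> k * f (inverse z) - B_coeff N \<alpha> \<beta> k * f (z / q ^ k))"
    by (simp add: algebra_simps)
  also have "\<dots> = (\<Sum>k<N. B_coeff N \<alpha> \<beta> k) * f (inverse z) - (\<Sum>k<N. B_coeff N \<alpha> \<beta> k * f (z / q ^ k))"
    by (simp only: sum_subtractf sum_distrib_right)
  finally show ?thesis unfolding sum_B_coeff[OF assms(2)] by (simp add: algebra_simps)
qed

text \<open>The factor \<open>z\<close> and its reflection differ by \<open>q\<^sup>k/z - z = (q\<^sup>k - z\<^sup>2)/z\<close>, which cancels the
  denominator of \<open>A\<^sub>k\<close>. So the commutator of \<open>L\<close> with \<open>z\<close> has polynomial coefficients.\<close>

lemma L_op_mult: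
  assumes "primitive_root_of_unity N q" "N \<ge> 1" "z \<in> regular_points N q"
    and dg: "g field_differentiable at z"
  shows "L_op N q \<alpha> \<beta> (\<lambda>w. w * g w) z = z * L_op N q \<alpha> \<beta> g z + z * g z
     + (\<Sum>k<N. (z * B_coeff N \<alpha> \<beta> k + D_coeff N q \<alpha> \<beta> k) * g (q ^ k / z))"
proof -
  note z = regular_pointsD[OF assms(1-3)]
  have "((\<lambda>w. w * g w) has_field_derivative g z + z * deriv g z) (at z)"
    using dg[unfolded DERIV_deriv_iff_field_differentiable[symmetric]]
    by (auto intro!: derivative_eq_intros)
  then have d: "deriv (\<lambda>w. w * g w) z = g z + z * deriv g z" by (rule DERIV_imp_deriv)
  have "A_coeff N q \<alpha> \<beta> k z * (q ^ k / z * g (q ^ k / z) - z * g z) =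
     z * (A_coeff N q \<alpha> \<beta> k z * (g (q ^ k / z) - g z))
     + (z * B_coeff N \<alpha> \<beta> k + D_coeff N q \<alpha> \<beta> k) * g (q ^ k / z)" for k
    unfolding A_coeff_times[OF z, symmetric] by (simp add: algebra_simps)
  then show ?thesis unfolding L_op_def refl_op_def d
    by (simp only: sum.distrib sum_distrib_left[symmetric]) (simp add: algebra_simps)
qed

text \<open>The factor \<open>z\<close> and its reflection differ by \<open>q\<^sup>k/z - z = (q\<^sup>k - z\<^sup>2)/z\<close>, which cancels the
  denominator of \<open>A\<^sub>k\<close>. So the commutator of \<open>L\<close> with \<open>z\<close> has polynomial coefficients.\<close>

text \<open>The contributions of the \<open>B\<^sub>k\<close> from the two preceding lemmas cancel.\<close>

lemma L_op_mult_reflect: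
  assumes "primitive_root_of_unity N q" "N \<ge> 1" "z \<in> regular_points N q"
    and df: "f field_differentiable at (inverse z)"
  shows "L_op N q \<alpha> \<beta> (\<lambda>w. w * f (inverse w)) z =
     z * ((1 + of_nat N * of_real (\<alpha> + \<beta> + 1)) * f (inverse z) - L_op N q \<alpha> \<beta> f (inverse z))
     + (\<Sum>k<N. D_coeff N q \<alpha> \<beta> k * f (z / q ^ k))"
proof -
  note z = regular_pointsD[OF assms(1-3)]
  have "(\<lambda>w. f (inverse w)) field_differentiable at z"
    by (rule field_differentiable_reflect[OF z(1) df])
  from L_op_mult[OF assms(1-3) this, of \<alpha> \<beta>]
  show ?thesis unfolding L_op_reflect[OF assms(1-3) df]
    by (simp add: algebra_simps sum.distrib sum_distrib_left)
qed

section \<open>The eigenfunctions of \<open>L\<close>\<close>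

definition cmv_even :: "nat \<Rightarrow> real \<Rightarrow> real \<Rightarrow> nat \<Rightarrow> complex \<Rightarrow> complex" where
  "cmv_even N \<alpha> \<beta> n z = z ^ n * poly (sieved_opuc N \<alpha> \<beta> (2 * n)) (inverse z)"

definition cmv_odd :: "nat \<Rightarrow> real \<Rightarrow> real \<Rightarrow> nat \<Rightarrow> complex \<Rightarrow> complex" where
  "cmv_odd N \<alpha> \<beta> n z = inverse z ^ n * poly (sieved_opuc N \<alpha> \<beta> (2 * n + 1)) z"

lemma field_differentiable_cmv:
  assumes "z \<noteq> 0"
  shows "cmv_even N \<alpha> \<beta> n field_differentiable at z" "cmv_odd N \<alpha> \<beta> n field_differentiable at z"
proof -
  have p: "poly r field_differentiable at w" for r :: "complex poly" and w
    using poly_DERIV field_differentiable_def by blast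
  have "(\<lambda>w. poly r (inverse w)) field_differentiable at z" for r :: "complex poly"
    using field_differentiable_compose[OF field_differentiable_inverse[OF field_differentiable_ident assms] p]
    by (simp add: o_def)
  then show "cmv_even N \<alpha> \<beta> n field_differentiable at z"
    unfolding cmv_even_def by (intro derivative_intros) auto
  have "(\<lambda>w. inverse w ^ n) field_differentiable at z"
    using assms by (intro derivative_intros) auto
  then show "cmv_odd N \<alpha> \<beta> n field_differentiable at z"
    unfolding cmv_odd_def by (rule field_differentiable_mult[OF _ p])
qed

lemma cmv_odd_rec:
  assumes "z \<noteq> 0"
  shows "cmv_odd N \<alpha> \<beta> n z = 1 * (z * cmv_even N \<alpha> \<beta> n (inverse z))
     + (- of_real (sieved_verblunsky N \<alpha> \<beta> (2 * n))) * cmv_even N \<alpha> \<beta> n z"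
proof -
  have "inverse z ^ n * z ^ (2 * n) = z ^ n"
    using assms by (simp add: mult_2 mult_2_right power_add field_simps)
  moreover have "cmv_odd N \<alpha> \<beta> n z = z * (inverse z ^ n * poly (sieved_opuc N \<alpha> \<beta> (2 * n)) z)
      - of_real (sieved_verblunsky N \<alpha> \<beta> (2 * n)) *
        ((inverse z ^ n * z ^ (2 * n)) * poly (sieved_opuc N \<alpha> \<beta> (2 * n)) (inverse z))"
    unfolding cmv_odd_def Suc_eq_plus1[symmetric] poly_sieved_opuc_Suc[OF assms]
    by (simp only: right_diff_distrib mult_ac)
  ultimately show ?thesis by (simp add: cmv_even_def)
qed

lemma cmv_even_rec:
  assumes "z \<noteq> 0"
  shows "cmv_even N \<alpha> \<beta> (Suc n) z = 1 * cmv_odd N \<alpha> \<beta> n (inverse z)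
     + (- of_real (sieved_verblunsky N \<alpha> \<beta> (2 * n + 1))) * cmv_odd N \<alpha> \<beta> n z"
proof -
  have "inverse z \<noteq> 0" using assms by simp
  note s = poly_sieved_opuc_Suc[OF this, of N \<alpha> \<beta> "2 * n + 1"]
  have "z ^ Suc n * inverse z ^ (2 * n + 1) = inverse z ^ n" "z ^ Suc n * inverse z = z ^ n"
    using assms by (simp_all add: mult_2 mult_2_right power_add field_simps)
  moreover have "cmv_even N \<alpha> \<beta> (Suc n) z =
      (z ^ Suc n * inverse z) * poly (sieved_opuc N \<alpha> \<beta> (2 * n + 1)) (inverse z)
      - of_real (sieved_verblunsky N \<alpha> \<beta> (2 * n + 1)) *
        ((z ^ Suc n * inverse z ^ (2 * n + 1)) * poly (sieved_opuc N \<alpha> \<beta> (2 * n + 1)) z)"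
  proof -
    have e: "2 * Suc n = Suc (2 * n + 1)" by simp
    show ?thesis
      unfolding cmv_even_def e s inverse_inverse_eq by (simp only: right_diff_distrib mult_ac)
  qed
  ultimately show ?thesis by (simp only: cmv_odd_def inverse_inverse_eq mult_1 mult_minus_left diff_conv_add_uminus mult.assoc)
qed

lemma homogeneous_iterate:
  fixes f :: "complex \<Rightarrow> complex"
  assumes "\<And>w. w \<noteq> 0 \<Longrightarrow> f (w / q) = s * f w" "q \<noteq> 0" "z \<noteq> 0"
  shows "f (z / q ^ k) = s ^ k * f z"
proof (induction k)
  case (Suc k)
  have "f (z / q ^ Suc k) = f (z / q ^ k / q)" by (simp add: field_simps)
  also have "\<dots> = s * f (z / q ^ k)" using assms(2,3) by (intro assms(1)) simp
  finally show ?case using Suc by simp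
qed simp

lemma cmv_even_homogeneous:
  assumes "primitive_root_of_unity N q" "N \<ge> 1" "z \<noteq> 0"
  shows "cmv_even N \<alpha> \<beta> n (z / q ^ k) = (q ^ n) ^ k * cmv_even N \<alpha> \<beta> n z"
proof (rule homogeneous_iterate)
  show q0: "q \<noteq> 0" using root_of_unity_nonzero assms by blast
  fix w :: complex assume "w \<noteq> 0"
  then have "inverse w \<noteq> 0" by simp
  from sieved_opuc_homogeneous[OF assms(1,2) this, of \<alpha> \<beta> "2 * n"]
  show "cmv_even N \<alpha> \<beta> n (w / q) = q ^ n * cmv_even N \<alpha> \<beta> n w"
    using q0 by (simp add: cmv_even_def field_simps mult_2 mult_2_right power_add)
qed fact

text \<open>The exponent is \<open>n - (2 n + 1) = -(n + 1)\<close>: the rotation \<open>z \<mapsto> z/q\<close> multiplies \<open>z\<^sup>-\<^sup>n\<close> by \<open>q\<^sup>n\<close> and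
  \<open>\<Phi>\<^sub>2\<^sub>n\<^sub>+\<^sub>1\<close> by \<open>q\<^bsup>-(2n + 1)\<^esup>\<close>.\<close>

lemma cmv_odd_homogeneous:
  assumes "primitive_root_of_unity N q" "N \<ge> 1" "z \<noteq> 0"
  shows "cmv_odd N \<alpha> \<beta> n (z / q ^ k) = (inverse q ^ (n + 1)) ^ k * cmv_odd N \<alpha> \<beta> n z"
proof (rule homogeneous_iterate)
  show q0: "q \<noteq> 0" using root_of_unity_nonzero assms by blast
  fix w :: complex assume w: "w \<noteq> 0"
  then have "w / q \<noteq> 0" using q0 by simp
  from sieved_opuc_homogeneous[OF assms(1,2) this, of \<alpha> \<beta> "2 * n + 1"]
  have "poly (sieved_opuc N \<alpha> \<beta> (2 * n + 1)) (w / q) =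
        inverse q ^ (2 * n + 1) * poly (sieved_opuc N \<alpha> \<beta> (2 * n + 1)) w"
    using q0 by (simp add: field_simps del: sieved_opuc.simps)
  moreover have "inverse (w / q) ^ n * inverse q ^ (2 * n + 1) = inverse q ^ (n + 1) * inverse w ^ n"
    using q0 by (simp add: field_simps mult_2 mult_2_right power_add)
  ultimately show "cmv_odd N \<alpha> \<beta> n (w / q) = inverse q ^ (n + 1) * cmv_odd N \<alpha> \<beta> n w"
    unfolding cmv_odd_def by (metis mult.assoc)
qed fact

text \<open>For even \<open>N\<close> both sides vanish, since \<open>N\<close> cannot divide \<open>2 n + 1\<close>. For odd \<open>N\<close> the sum is
  geometric with ratio \<open>h q\<^sup>n\<close>, where \<open>h\<^sup>2 = q\<close>. As squaring is injective on the \<open>N\<close>-th roots of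
  unity, the ratio is \<open>1\<close> exactly when \<open>q\<^bsup>2n + 1\<^esup> = 1\<close>. The quotient \<open>(2 n + 1)/N\<close> is then odd, which
  selects the value \<open>d\<close> in the Verblunsky parameter.\<close>

lemma sum_D_cmv_even:
  assumes "primitive_root_of_unity N q" "N \<ge> 1" "\<alpha> > -1" "\<beta> > -1" "z \<noteq> 0"
  shows "(\<Sum>k<N. D_coeff N q \<alpha> \<beta> k * cmv_even N \<alpha> \<beta> n (z / q ^ k)) =
    - of_real (sieved_verblunsky N \<alpha> \<beta> (2 * n)) * (of_nat (2 * n + 1) + of_nat N * of_real (\<alpha> + \<beta> + 1))
    * cmv_even N \<alpha> \<beta> n z"
proof (cases "even N")
  case True
  then have "\<not> N dvd 2 * n + 1" by (meson dvd_trans even_plus_one_iff dvd_triv_left)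
  then show ?thesis using True by (simp add: D_coeff_def sieved_verblunsky_def)
next
  case False
  define m where "m = (N + 1) div 2"
  have m: "2 * m = N + 1" using False by (simp add: m_def)
  define w where "w = q ^ (m + n)"
  have wN: "w ^ N = 1" unfolding w_def by (rule root_of_unity_power_power[OF assms(1)])
  have "w = 1 \<longleftrightarrow> N dvd m + n"
    unfolding w_def by (rule root_of_unity_power_eq_1_iff[OF assms(1,2)])
  also have "\<dots> \<longleftrightarrow> N dvd 2 * (m + n)"
    using False by (intro coprime_dvd_mult_right_iff[symmetric]) simp
  also have "2 * (m + n) = N + (2 * n + 1)" using m by simp
  finally have w1: "w = 1 \<longleftrightarrow> N dvd 2 * n + 1" by (simp only: dvd_add_right_iff[OF dvd_refl])
  have odd: "odd ((2 * n + 1) div N)" if "N dvd 2 * n + 1"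
    using that by (metis dvd_mult_div_cancel even_mult_iff even_plus_one_iff dvd_triv_left)
  have "D_coeff N q \<alpha> \<beta> k * cmv_even N \<alpha> \<beta> n (z / q ^ k) =
      of_real (\<alpha> - \<beta>) * cmv_even N \<alpha> \<beta> n z * w ^ k" for k
    using False by (simp add: D_coeff_def rho_eq_power[OF assms(1,2) False]
        cmv_even_homogeneous[OF assms(1,2,5)] w_def m_def power_add power_mult_distrib)
  then have "(\<Sum>k<N. D_coeff N q \<alpha> \<beta> k * cmv_even N \<alpha> \<beta> n (z / q ^ k)) =
      of_real (\<alpha> - \<beta>) * cmv_even N \<alpha> \<beta> n z * (if w = 1 then of_nat N else 0)"
    by (simp only: sum_distrib_left[symmetric] sum_powers_root_of_unity[OF wN])
  also have "\<dots> = - of_real (sieved_verblunsky N \<alpha> \<beta> (2 * n) *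
      (real (2 * n) + 1 + real N * (\<alpha> + \<beta> + 1))) * cmv_even N \<alpha> \<beta> n z"
    unfolding sieved_verblunsky_times[OF assms(2-4)] using odd by (simp add: w1)
  finally show ?thesis by simp
qed

text \<open>The part of \<open>B\<^sub>k\<close> with \<open>c\<close> gives a geometric sum with ratio \<open>w = q\<^bsup>-(n + 1)\<^esup>\<close>; for even \<open>N\<close> the part
  with \<open>(-1)\<^sup>k d\<close> gives one with ratio \<open>-w\<close>. If \<open>w = 1\<close>, then \<open>N\<close> divides \<open>2 n + 2\<close> with even
  quotient; if \<open>-w = 1\<close>, it divides with odd quotient. This is the parity that selects \<open>c\<close> or \<open>d\<close>
  in the Verblunsky parameter.\<close>

lemma sum_B_cmv_odd:
  assumes "primitive_root_of_unity N q" "N \<ge> 1" "\<alpha> > -1" "\<beta> > -1" "z \<noteq> 0"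
  shows "(\<Sum>k<N. B_coeff N \<alpha> \<beta> k * cmv_odd N \<alpha> \<beta> n (z / q ^ k)) =
    - of_real (sieved_verblunsky N \<alpha> \<beta> (2 * n + 1)) * (of_nat (2 * n + 2) + of_nat N * of_real (\<alpha> + \<beta> + 1))
    * cmv_odd N \<alpha> \<beta> n z"
proof -
  define w where "w = inverse q ^ (n + 1)"
  have q0: "q \<noteq> 0" using root_of_unity_nonzero assms by blast
  have wN: "w ^ N = 1"
    unfolding w_def power_inverse root_of_unity_power_power[OF assms(1)] by simp
  have w1: "w = 1 \<longleftrightarrow> N dvd n + 1"
    unfolding w_def root_of_unity_power_eq_1_iff[OF assms(1,2), of "n+1", symmetric]
    by (simp only: power_inverse inverse_eq_1_iff)
  have even_quot: "N dvd n + 1 \<longleftrightarrow> N dvd 2 * n + 2 \<and> even ((2 * n + 2) div N)"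
  proof
    assume "N dvd n + 1"
    then obtain j where "n + 1 = N * j" by auto
    then have "2 * n + 2 = N * (2 * j)" by simp
    then show "N dvd 2 * n + 2 \<and> even ((2 * n + 2) div N)" using assms(2) by simp
  next
    assume a: "N dvd 2 * n + 2 \<and> even ((2 * n + 2) div N)"
    then obtain j where "(2 * n + 2) div N = 2 * j" by auto
    then have "2 * n + 2 = N * (2 * j)" using a by (metis dvd_mult_div_cancel)
    then have "n + 1 = N * j" by simp
    then show "N dvd n + 1" by simp
  qed
  have G: "(\<Sum>k<N. B_coeff N \<alpha> \<beta> k * w ^ k) =
     (if N dvd 2 * n + 2 then of_nat N * of_real (if even ((2 * n + 2) div N) then \<alpha> + \<beta> + 1 else \<alpha> - \<beta>) else 0)"
  proof (cases "even N")
    case True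
    define m where "m = N div 2"
    have m: "N = 2 * m" using True by (simp add: m_def)
    have mN: "(- w) ^ N = 1" using True wN by simp
    have w2: "- w = 1 \<longleftrightarrow> N dvd 2 * n + 2 \<and> odd ((2 * n + 2) div N)"
    proof -
      \<comment> \<open>\<open>q\<^sup>m = -1\<close> absorbs the sign, and \<open>N = 2 m\<close> divides \<open>m + (n + 1)\<close> iff
        \<open>2 n + 2\<close> is an odd multiple of \<open>N\<close>\<close>
      have "- w = 1 \<longleftrightarrow> q ^ (m + (n + 1)) = 1"
      proof -
        have "w * q ^ (n + 1) = 1" unfolding w_def power_inverse by (rule left_inverse) (simp add: q0)
        then have "w = -1 \<longleftrightarrow> q ^ (n + 1) = -1"
          by (metis mult_minus1 mult_minus1_right minus_minus)
        moreover have "q ^ (m + (n + 1)) = - (q ^ (n + 1))"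
          unfolding m_def power_add root_of_unity_power_half[OF assms(1,2) True] by simp
        ultimately show ?thesis by (metis minus_minus)
      qed
      also have "\<dots> \<longleftrightarrow> N dvd m + (n + 1)" by (rule root_of_unity_power_eq_1_iff[OF assms(1,2)])
      also have "\<dots> \<longleftrightarrow> N dvd 2 * n + 2 \<and> odd ((2 * n + 2) div N)"
      proof
        assume "N dvd m + (n + 1)"
        then obtain j where j: "m + (n + 1) = 2 * m * j" using m by auto
        then have "j \<ge> 1" by (cases j) auto
        then obtain i where "j = Suc i" by (cases j) auto
        then have "2 * n + 2 = N * (2 * i + 1)" using j m by (simp add: algebra_simps)
        then show "N dvd 2 * n + 2 \<and> odd ((2 * n + 2) div N)" using assms(2) by simp
      next
        assume a: "N dvd 2 * n + 2 \<and> odd ((2 * n + 2) div N)"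
        then obtain j where "(2 * n + 2) div N = 2 * j + 1" using oddE by blast
        then have "2 * n + 2 = N * (2 * j + 1)" using a by (metis dvd_mult_div_cancel)
        then have "m + (n + 1) = N * (j + 1)" using m by (simp add: algebra_simps)
        then show "N dvd m + (n + 1)" by simp
      qed
      finally show ?thesis .
    qed
    have "B_coeff N \<alpha> \<beta> k * w ^ k = of_real (\<alpha> + \<beta> + 1) * w ^ k + of_real (\<alpha> - \<beta>) * (- w) ^ k" for k
      using True by (simp add: B_coeff_def algebra_simps power_minus[of w])
    then have "(\<Sum>k<N. B_coeff N \<alpha> \<beta> k * w ^ k) =
      of_real (\<alpha> + \<beta> + 1) * (if w = 1 then of_nat N else 0)
      + of_real (\<alpha> - \<beta>) * (if - w = 1 then of_nat N else 0)"
      by (simp only: sum.distrib sum_distrib_left[symmetric] sum_powers_root_of_unity[OF wN]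
          sum_powers_root_of_unity[OF mN])
    then show ?thesis unfolding w1 w2 even_quot by auto
  next
    case False
    have "N dvd 2 * n + 2 \<longleftrightarrow> N dvd 2 * (n + 1)" by simp
    also have "\<dots> \<longleftrightarrow> N dvd n + 1"
      using False by (intro coprime_dvd_mult_right_iff) simp
    finally have e: "N dvd 2 * n + 2 \<longleftrightarrow> N dvd n + 1" .
    have "(\<Sum>k<N. B_coeff N \<alpha> \<beta> k * w ^ k) = of_real (\<alpha> + \<beta> + 1) * (if w = 1 then of_nat N else 0)"
      unfolding sum_powers_root_of_unity[OF wN, symmetric] using False
      by (simp add: B_coeff_def sum_distrib_left)
    then show ?thesis unfolding w1 using e even_quot by auto
  qed
  have "B_coeff N \<alpha> \<beta> k * cmv_odd N \<alpha> \<beta> n (z / q ^ k) =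
      B_coeff N \<alpha> \<beta> k * w ^ k * cmv_odd N \<alpha> \<beta> n z" for k
    by (simp add: cmv_odd_homogeneous[OF assms(1,2,5)] w_def)
  then have "(\<Sum>k<N. B_coeff N \<alpha> \<beta> k * cmv_odd N \<alpha> \<beta> n (z / q ^ k)) =
      (\<Sum>k<N. B_coeff N \<alpha> \<beta> k * w ^ k) * cmv_odd N \<alpha> \<beta> n z"
    by (simp only: sum_distrib_right[symmetric])
  also have "\<dots> = - of_real (sieved_verblunsky N \<alpha> \<beta> (2 * n + 1) *
      (real (2 * n + 1) + 1 + real N * (\<alpha> + \<beta> + 1))) * cmv_odd N \<alpha> \<beta> n z"
    unfolding sieved_verblunsky_times[OF assms(2-4)] G by simp
  finally show ?thesis by simp
qed

text \<open>On \<open>z R u\<^sub>n\<close> the operator \<open>L\<close> already acts by \<open>n + 1 + N c\<close>, up to a rotation sum of \<open>u\<^sub>n\<close>. The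
  term \<open>-a\<^sub>2\<^sub>n u\<^sub>n\<close>, on which \<open>L\<close> acts by \<open>-n\<close>, compensates that sum.\<close>

lemma L_op_cmv_odd_step:
  assumes "primitive_root_of_unity N q" "N \<ge> 1" "\<alpha> > -1" "\<beta> > -1"
    and even: "\<And>z. z \<in> regular_points N q \<Longrightarrow>
      L_op N q \<alpha> \<beta> (cmv_even N \<alpha> \<beta> n) z = - of_nat n * cmv_even N \<alpha> \<beta> n z"
    and z: "z \<in> regular_points N q"
  shows "L_op N q \<alpha> \<beta> (cmv_odd N \<alpha> \<beta> n) z =
    (of_nat (Suc n) + of_nat N * of_real (\<alpha> + \<beta> + 1)) * cmv_odd N \<alpha> \<beta> n z"
proof -
  note z' = regular_pointsD[OF assms(1,2) z]
  have iz: "inverse z \<in> regular_points N q"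
    using reflection_regular_points[OF assms(1,2) z, of 0] by (simp add: field_simps)
  have dr: "(\<lambda>w. w * cmv_even N \<alpha> \<beta> n (inverse w)) field_differentiable at z"
    using z'(1) by (intro field_differentiable_mult field_differentiable_ident
        field_differentiable_reflect field_differentiable_cmv) auto
  let ?a = "of_real (sieved_verblunsky N \<alpha> \<beta> (2 * n)) :: complex"
  have "L_op N q \<alpha> \<beta> (cmv_odd N \<alpha> \<beta> n) z =
     L_op N q \<alpha> \<beta> (\<lambda>w. 1 * (w * cmv_even N \<alpha> \<beta> n (inverse w)) + (- ?a) * cmv_even N \<alpha> \<beta> n w) z"
    using regular_pointsD(1)[OF assms(1,2)]
    by (intro L_op_cong[OF assms(1,2) z] cmv_odd_rec)
  also have "\<dots> = 1 * L_op N q \<alpha> \<beta> (\<lambda>w. w * cmv_even N \<alpha> \<beta> n (inverse w)) z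
      + (- ?a) * L_op N q \<alpha> \<beta> (cmv_even N \<alpha> \<beta> n) z"
    by (intro L_op_linear dr field_differentiable_cmv z')
  also have "\<dots> = (of_nat (Suc n) + of_nat N * of_real (\<alpha> + \<beta> + 1)) * cmv_odd N \<alpha> \<beta> n z"
    unfolding L_op_mult_reflect[OF assms(1,2) z field_differentiable_cmv(1)[OF regular_pointsD(1)[OF assms(1,2) iz]]] even[OF z] even[OF iz]
      cmv_odd_rec[OF z'(1)] sum_D_cmv_even[OF assms(1-4) z'(1)]
    by (simp add: algebra_simps)
  finally show ?thesis .
qed

text \<open>On \<open>R v\<^sub>n\<close> the operator \<open>L\<close> acts by \<open>-(n + 1 + N c) + N c = -(n + 1)\<close>, up to a rotation sum of
  \<open>v\<^sub>n\<close>, which the term \<open>-a\<^sub>2\<^sub>n\<^sub>+\<^sub>1 v\<^sub>n\<close> compensates.\<close>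

lemma L_op_cmv_even_step:
  assumes "primitive_root_of_unity N q" "N \<ge> 1" "\<alpha> > -1" "\<beta> > -1"
    and odd: "\<And>z. z \<in> regular_points N q \<Longrightarrow> L_op N q \<alpha> \<beta> (cmv_odd N \<alpha> \<beta> n) z =
      (of_nat (Suc n) + of_nat N * of_real (\<alpha> + \<beta> + 1)) * cmv_odd N \<alpha> \<beta> n z"
    and z: "z \<in> regular_points N q"
  shows "L_op N q \<alpha> \<beta> (cmv_even N \<alpha> \<beta> (Suc n)) z = - of_nat (Suc n) * cmv_even N \<alpha> \<beta> (Suc n) z"
proof -
  note z' = regular_pointsD[OF assms(1,2) z]
  have iz: "inverse z \<in> regular_points N q"
    using reflection_regular_points[OF assms(1,2) z, of 0] by (simp add: field_simps)
  have dr: "(\<lambda>w. cmv_odd N \<alpha> \<beta> n (inverse w)) field_differentiable at z"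
    using z'(1) by (intro field_differentiable_reflect field_differentiable_cmv) auto
  let ?a = "of_real (sieved_verblunsky N \<alpha> \<beta> (2 * n + 1)) :: complex"
  have "L_op N q \<alpha> \<beta> (cmv_even N \<alpha> \<beta> (Suc n)) z =
     L_op N q \<alpha> \<beta> (\<lambda>w. 1 * cmv_odd N \<alpha> \<beta> n (inverse w) + (- ?a) * cmv_odd N \<alpha> \<beta> n w) z"
    using regular_pointsD(1)[OF assms(1,2)]
    by (intro L_op_cong[OF assms(1,2) z] cmv_even_rec)
  also have "\<dots> = 1 * L_op N q \<alpha> \<beta> (\<lambda>w. cmv_odd N \<alpha> \<beta> n (inverse w)) z
      + (- ?a) * L_op N q \<alpha> \<beta> (cmv_odd N \<alpha> \<beta> n) z"
    by (intro L_op_linear dr field_differentiable_cmv z')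
  also have "\<dots> = - of_nat (Suc n) * cmv_even N \<alpha> \<beta> (Suc n) z"
    unfolding L_op_reflect[OF assms(1,2) z field_differentiable_cmv(2)[OF regular_pointsD(1)[OF assms(1,2) iz]]] odd[OF z] odd[OF iz]
      cmv_even_rec[OF z'(1)] sum_B_cmv_odd[OF assms(1-4) z'(1)]
    by (simp add: algebra_simps)
  finally show ?thesis .
qed

lemma L_op_cmv_even:
  assumes "primitive_root_of_unity N q" "N \<ge> 1" "\<alpha> > -1" "\<beta> > -1" "z \<in> regular_points N q"
  shows "L_op N q \<alpha> \<beta> (cmv_even N \<alpha> \<beta> n) z = - of_nat n * cmv_even N \<alpha> \<beta> n z"
  using assms(5)
proof (induction n arbitrary: z)
  case 0
  have "cmv_even N \<alpha> \<beta> 0 = (\<lambda>_. 1)" by (simp add: cmv_even_def fun_eq_iff)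
  then show ?case by (simp add: L_op_def refl_op_def)
next
  case (Suc n)
  show ?case
    by (rule L_op_cmv_even_step[OF assms(1-4) L_op_cmv_odd_step[OF assms(1-4) Suc.IH] Suc.prems])
qed

lemma L_op_cmv_odd:
  assumes "primitive_root_of_unity N q" "N \<ge> 1" "\<alpha> > -1" "\<beta> > -1" "z \<in> regular_points N q"
  shows "L_op N q \<alpha> \<beta> (cmv_odd N \<alpha> \<beta> n) z =
    (of_nat (Suc n) + of_nat N * of_real (\<alpha> + \<beta> + 1)) * cmv_odd N \<alpha> \<beta> n z"
  by (rule L_op_cmv_odd_step[OF assms(1-4) L_op_cmv_even[OF assms(1-4)] assms(5)])

text \<open>The recurrence for \<open>u\<^sub>n\<^sub>+\<^sub>1\<close> puts \<open>R v\<^sub>n\<close> into the span of \<open>v\<^sub>n\<close> and \<open>u\<^sub>n\<^sub>+\<^sub>1\<close>. The cases \<open>e = 1\<close> and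
  \<open>e = -1\<close> serve the polynomials of the first and of the second kind.\<close>

lemma H_op_cmv_odd_reflect:
  fixes e :: complex
  assumes "primitive_root_of_unity N q" "N \<ge> 1" "\<alpha> > -1" "\<beta> > -1" "z \<in> regular_points N q"
  shows "H_op N q \<alpha> \<beta> (\<lambda>w. cmv_odd N \<alpha> \<beta> n w + e * cmv_odd N \<alpha> \<beta> n (inverse w)) z =
    of_real (Lambda N \<alpha> \<beta> (Suc n)) * (cmv_odd N \<alpha> \<beta> n z + e * cmv_odd N \<alpha> \<beta> n (inverse z))"
proof -
  let ?a = "of_real (sieved_verblunsky N \<alpha> \<beta> (2 * n + 1)) :: complex"
  have eq: "cmv_odd N \<alpha> \<beta> n w + e * cmv_odd N \<alpha> \<beta> n (inverse w) =
      (1 + e * ?a) * cmv_odd N \<alpha> \<beta> n w + e * cmv_even N \<alpha> \<beta> (Suc n) w"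
    if "w \<in> regular_points N q" for w
    unfolding cmv_even_rec[OF regular_pointsD(1)[OF assms(1,2) that]] by (simp add: algebra_simps)
  have "H_op N q \<alpha> \<beta> (\<lambda>w. cmv_odd N \<alpha> \<beta> n w + e * cmv_odd N \<alpha> \<beta> n (inverse w)) z =
     H_op N q \<alpha> \<beta> (\<lambda>w. (1 + e * ?a) * cmv_odd N \<alpha> \<beta> n w + e * cmv_even N \<alpha> \<beta> (Suc n) w) z"
    by (rule H_op_cong[OF assms(1,2,5) eq])
  also have "\<dots> = of_real (Lambda N \<alpha> \<beta> (Suc n)) *
     ((1 + e * ?a) * cmv_odd N \<alpha> \<beta> n z + e * cmv_even N \<alpha> \<beta> (Suc n) z)"
    by (rule H_op_eigenvector_sum[OF assms(1,2,5) field_differentiable_cmv(2,1)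
          L_op_cmv_odd[OF assms(1-4)] L_op_cmv_even[OF assms(1-4)]])
      (simp_all add: Lambda_def power2_eq_square algebra_simps)
  finally show ?thesis unfolding eq[OF assms(5)] .
qed

section \<open>The polynomials in \<open>z + z\<inverse>\<close>\<close>

text \<open>Rescaled Chebyshev polynomials: \<open>a = 2\<close> gives \<open>2 T\<^sub>k(x/2)\<close> and \<open>a = 1\<close> gives \<open>U\<^sub>k(x/2)\<close>. They
  express the symmetric and the divided antisymmetric Laurent monomials through \<open>z + 1/z\<close>.\<close>

fun cheb :: "complex \<Rightarrow> nat \<Rightarrow> complex poly" where
  "cheb a 0 = [:a:]"
| "cheb a (Suc 0) = [:0, 1:]"
| "cheb a (Suc (Suc k)) = pCons 0 (cheb a (Suc k)) - cheb a k"

lemma coeff_cheb: "k < m \<Longrightarrow> coeff (cheb a k) m = 0"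
  by (induction a k arbitrary: m rule: cheb.induct)
    (auto simp: coeff_pCons split: nat.splits)

lemma lead_coeff_cheb: "coeff (cheb a (Suc k)) (Suc k) = 1"
  by (induction k) (auto simp: coeff_cheb)

lemma poly_cheb_first:
  assumes "z \<noteq> 0"
  shows "poly (cheb 2 k) (z + inverse z) = z ^ k + inverse z ^ k"
proof -
  have "poly (cheb a k) (z + inverse z) = z ^ k + inverse z ^ k" if "a = 2" for a
    using that
  proof (induction a k rule: cheb.induct)
    case (3 a k)
    have "(z + w) * (z * u + w * v) - (u + v) = z * (z * u) + w * (w * v)" if "z * w = 1" for w u v
      using that by algebra
    from this[of "inverse z" "z ^ k" "inverse z ^ k"] show ?case using 3 assms by simp
  qed auto
  then show ?thesis by simp
qed

lemma poly_cheb_second: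
  assumes "z \<noteq> 0"
  shows "(z - inverse z) * poly (cheb 1 k) (z + inverse z) = z ^ Suc k - inverse z ^ Suc k"
proof -
  have "(z - inverse z) * poly (cheb a k) (z + inverse z) = z ^ Suc k - inverse z ^ Suc k"
    if "a = 1" for a
    using that
  proof (induction a k rule: cheb.induct)
    case (3 a k)
    have "(z - inverse z) * poly (cheb a (Suc (Suc k))) (z + inverse z) =
       (z + inverse z) * ((z - inverse z) * poly (cheb a (Suc k)) (z + inverse z))
       - (z - inverse z) * poly (cheb a k) (z + inverse z)"
      by (simp add: algebra_simps)
    also have "\<dots> = (z + inverse z) * (z ^ Suc (Suc k) - inverse z ^ Suc (Suc k))
       - (z ^ Suc k - inverse z ^ Suc k)"
      using 3 by simp
    also have "\<dots> = z ^ Suc (Suc (Suc k)) - inverse z ^ Suc (Suc (Suc k))"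
    proof -
      have "(z + w) * (z * (z * u) - w * (w * v)) - (z * u - w * v) = z * (z * (z * u)) - w * (w * (w * v))"
        if "z * w = 1" for w u v
        using that by algebra
      from this[of "inverse z" "z ^ k" "inverse z ^ k"] show ?thesis using assms by simp
    qed
    finally show ?case .
  qed (auto simp: algebra_simps)
  then show ?thesis by simp
qed

text \<open>Every \<open>x \<noteq> \<plusminus>2\<close> is \<open>z + 1/z\<close> for some admissible \<open>z\<close>, so the two polynomials agree at infinitely
  many points.\<close>

lemma poly_eqI_joukowski:
  fixes p r :: "complex poly"
  assumes "\<And>z. z \<noteq> 0 \<Longrightarrow> z - inverse z \<noteq> 0 \<Longrightarrow> poly p (z + inverse z) = poly r (z + inverse z)"
  shows "p = r"
proof (rule ccontr)
  assume "p \<noteq> r"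
  then have "finite {x. poly (p - r) x = 0}" by (intro poly_roots_finite) simp
  moreover have "UNIV - {2, -2} \<subseteq> {x. poly (p - r) x = 0}"
  proof
    fix x :: complex assume x: "x \<in> UNIV - {2, -2}"
    define z where "z = (x + csqrt (x\<^sup>2 - 4)) / 2"
    have "2 * z - x = csqrt (x\<^sup>2 - 4)" by (simp add: z_def field_simps)
    then have "(2 * z - x)\<^sup>2 = x\<^sup>2 - 4" by (simp only: power2_csqrt)
    moreover have "4 * (z * (x - z)) = x\<^sup>2 - (2 * z - x)\<^sup>2"
      by (simp add: power2_eq_square algebra_simps)
    ultimately have e: "z * (x - z) = 1" by simp
    then have z0: "z \<noteq> 0" by auto
    have xz: "x = z + inverse z" using e z0 by (simp add: field_simps)
    have "z - inverse z \<noteq> 0"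
    proof
      assume "z - inverse z = 0"
      then have "z\<^sup>2 = 1" using z0 by (simp add: field_simps power2_eq_square)
      then have "z = 1 \<or> z = -1" by (simp add: power2_eq_1_iff)
      then show False using x xz by auto
    qed
    then show "x \<in> {x. poly (p - r) x = 0}" using assms z0 xz by simp
  qed
  ultimately have "finite (UNIV - {2, -2 :: complex})" by (rule rev_finite_subset)
  then show False using infinite_UNIV_char_0 by (metis Diff_infinite_finite finite.emptyI finite_insert)
qed

text \<open>Only the top term reaches degree \<open>d\<close>, so the sum inherits degree and leading coefficient from it.
  This replaces the powers \<open>z\<^sup>i\<close> of a monic polynomial by polynomials in \<open>z + 1/z\<close>.\<close>

lemma monic_sum:
  fixes V :: "nat \<Rightarrow> complex poly"
  assumes "degree p = M" "lead_coeff p = 1"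
    and low: "\<And>i m. i < M \<Longrightarrow> d \<le> m \<Longrightarrow> coeff (V i) m = 0"
    and top: "coeff (V M) d = 1" "\<And>m. d < m \<Longrightarrow> coeff (V M) m = 0"
  defines "r \<equiv> \<Sum>i\<le>M. smult (coeff p i) (V i)"
  shows "degree r = d \<and> lead_coeff r = 1"
proof -
  have c: "coeff r m = coeff (V M) m" if "d \<le> m" for m
    using that assms(1,2) low by (simp add: r_def coeff_sum flip: lessThan_Suc_atMost)
  have "degree r \<le> d" using c top(2) by (intro degree_le) auto
  moreover have "d \<le> degree r" using c top(1) by (intro le_degree) simp
  ultimately have "degree r = d" by simp
  then show ?thesis using c top(1) by simp
qed

lemma cmv_odd_sum:
  assumes "z \<noteq> 0"
  shows "cmv_odd N \<alpha> \<beta> n z =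
    (\<Sum>i\<le>2 * n + 1. coeff (sieved_opuc N \<alpha> \<beta> (2 * n + 1)) i * z powi (int i - int n))"
proof -
  have "cmv_odd N \<alpha> \<beta> n z =
    (\<Sum>i\<le>2 * n + 1. inverse z ^ n * (coeff (sieved_opuc N \<alpha> \<beta> (2 * n + 1)) i * z ^ i))"
    unfolding cmv_odd_def poly_altdef sum_distrib_left
    using sieved_opuc_monic[of N \<alpha> \<beta> "2 * n + 1"] by simp
  then show ?thesis using assms by (simp add: power_int_diff field_simps)
qed

text \<open>The monomial \<open>z\<^sup>i\<close> of \<open>\<Phi>\<^sub>2\<^sub>n\<^sub>+\<^sub>1\<close> contributes \<open>z\<^bsup>i - n\<^esup> + z\<^bsup>n - i\<^esup>\<close> to the right-hand side. The absolute
  value of the exponent is at most \<open>n\<close> except for \<open>i = 2 n + 1\<close>, where it is \<open>n + 1\<close>. This gives a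
  monic polynomial of degree \<open>n + 1\<close> with the defining property of \<open>P\<^sub>n\<^sub>+\<^sub>1\<close>.\<close>

lemma sieved_jacobi_P_eq:
  assumes "z \<noteq> 0"
  shows "poly (sieved_jacobi_P N \<alpha> \<beta> (Suc n)) (z + inverse z) =
    cmv_odd N \<alpha> \<beta> n z + cmv_odd N \<alpha> \<beta> n (inverse z)"
proof -
  let ?p = "sieved_opuc N \<alpha> \<beta> (2 * n + 1)"
  let ?S = "\<lambda>p. degree p = Suc n \<and> lead_coeff p = 1 \<and>
    (\<forall>z. z \<noteq> 0 \<longrightarrow> poly p (z + inverse z) = cmv_odd N \<alpha> \<beta> n z + cmv_odd N \<alpha> \<beta> n (inverse z))"
  define V where "V = (\<lambda>i. cheb 2 (nat \<bar>int i - int n\<bar>))"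
  define r where "r = (\<Sum>i\<le>2 * n + 1. smult (coeff ?p i) (V i))"
  have V: "poly (V i) (z + inverse z) = z powi (int i - int n) + inverse z powi (int i - int n)"
    if "z \<noteq> 0" for z i
    unfolding V_def poly_cheb_first[OF that]
    by (cases "n \<le> i") (simp_all add: power_int_def)
  have "degree r = Suc n \<and> lead_coeff r = 1"
    unfolding r_def using sieved_opuc_monic[of N \<alpha> \<beta> "2 * n + 1"]
    by (intro monic_sum) (auto simp: V_def coeff_cheb lead_coeff_cheb nat_add_distrib)
  moreover have "poly r (z + inverse z) = cmv_odd N \<alpha> \<beta> n z + cmv_odd N \<alpha> \<beta> n (inverse z)"
    if "z \<noteq> 0" for z
    using that by (simp add: r_def poly_sum V cmv_odd_sum distrib_left sum.distrib del: sieved_opuc.simps)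
  ultimately have r: "?S r" by blast
  have "(THE p. ?S p) = r"
  proof (rule the_equality)
    show "?S r" by (rule r)
    fix p assume "?S p"
    then show "p = r" using r by (intro poly_eqI_joukowski) auto
  qed
  moreover have "sieved_jacobi_P N \<alpha> \<beta> (Suc n) = (THE p. ?S p)"
    by (simp add: sieved_jacobi_P_def cmv_odd_def power_int_minus power_inverse del: sieved_opuc.simps)
  ultimately show ?thesis using r assms by metis
qed

text \<open>As for the first kind, with \<open>z\<^bsup>i - n\<^esup> - z\<^bsup>n - i\<^esup>\<close> in place of the symmetric monomials. After division by
  \<open>z - 1/z\<close> these are zero for \<open>i = n\<close> and otherwise, up to sign, polynomials in \<open>z + 1/z\<close> of degree
  \<open>\<bar>i - n\<bar> - 1\<close>.\<close>

lemma sieved_jacobi_Q_eq: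
  assumes "z \<noteq> 0" "z - inverse z \<noteq> 0"
  shows "(z - inverse z) * poly (sieved_jacobi_Q N \<alpha> \<beta> n) (z + inverse z) =
    cmv_odd N \<alpha> \<beta> n z - cmv_odd N \<alpha> \<beta> n (inverse z)"
proof -
  let ?p = "sieved_opuc N \<alpha> \<beta> (2 * n + 1)"
  let ?S = "\<lambda>p. degree p = n \<and> lead_coeff p = 1 \<and>
    (\<forall>z. z \<noteq> 0 \<and> z - inverse z \<noteq> 0 \<longrightarrow> poly p (z + inverse z) =
      (cmv_odd N \<alpha> \<beta> n z - cmv_odd N \<alpha> \<beta> n (inverse z)) / (z - inverse z))"
  define V where "V = (\<lambda>i. if i = n then 0 else if i < n then - cheb 1 (n - i - 1) else cheb 1 (i - n - 1))"
  define r where "r = (\<Sum>i\<le>2 * n + 1. smult (coeff ?p i) (V i))"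
  have V: "(z - inverse z) * poly (V i) (z + inverse z) =
      z powi (int i - int n) - inverse z powi (int i - int n)"
    if "z \<noteq> 0" for z i
  proof -
    consider "i = n" | k where "n = i + Suc k" | k where "i = n + Suc k"
      by (metis add_Suc_right less_imp_Suc_add linorder_neqE_nat)
    then show ?thesis
    proof cases
      case 2
      then show ?thesis using poly_cheb_second[OF that, of k]
        by (simp add: V_def power_int_minus power_int_def power_inverse nat_add_distrib algebra_simps)
    next
      case 3
      then show ?thesis using poly_cheb_second[OF that, of k]
        by (simp add: V_def power_int_def nat_add_distrib)
    qed (simp add: V_def)
  qed
  have top: "coeff (cheb 1 n) n = 1" by (cases n) (simp_all only: lead_coeff_cheb, simp)
  have "degree r = n \<and> lead_coeff r = 1"
    unfolding r_def using sieved_opuc_monic[of N \<alpha> \<beta> "2 * n + 1"] top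
    by (intro monic_sum) (auto simp: V_def coeff_cheb)
  moreover have "poly r (z + inverse z) =
      (cmv_odd N \<alpha> \<beta> n z - cmv_odd N \<alpha> \<beta> n (inverse z)) / (z - inverse z)"
    if "z \<noteq> 0" "z - inverse z \<noteq> 0" for z
  proof -
    have "(z - inverse z) * poly r (z + inverse z) =
       (\<Sum>i\<le>2 * n + 1. coeff ?p i * ((z - inverse z) * poly (V i) (z + inverse z)))"
      by (simp only: r_def poly_sum poly_smult sum_distrib_left mult.left_commute)
    also have "\<dots> = cmv_odd N \<alpha> \<beta> n z - cmv_odd N \<alpha> \<beta> n (inverse z)"
      using that(1) by (simp only: V cmv_odd_sum right_diff_distrib sum_subtractf
        inverse_nonzero_iff_nonzero not_False_eq_True)
    finally show ?thesis using that(2) by (simp add: nonzero_eq_divide_eq mult.commute)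
  qed
  ultimately have r: "?S r" by blast
  have "(THE p. ?S p) = r"
  proof (rule the_equality)
    show "?S r" by (rule r)
    fix p assume "?S p"
    then show "p = r" using r by (intro poly_eqI_joukowski) auto
  qed
  moreover have "sieved_jacobi_Q N \<alpha> \<beta> n = (THE p. ?S p)"
    by (simp add: sieved_jacobi_Q_def cmv_odd_def power_int_minus power_inverse del: sieved_opuc.simps)
  ultimately have "poly (sieved_jacobi_Q N \<alpha> \<beta> n) (z + inverse z) =
      (cmv_odd N \<alpha> \<beta> n z - cmv_odd N \<alpha> \<beta> n (inverse z)) / (z - inverse z)"
    using r assms by metis
  then show ?thesis using assms(2) by simp
qed

theorem proposition3:
  fixes N :: nat and q :: complex and \<alpha> \<beta> :: real
  assumes "N \<ge> 1" and "primitive_root_of_unity N q" and "\<alpha> > -1" and "\<beta> > -1"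
  shows "\<forall>n. \<forall>z \<in> regular_points N q.
      H_op N q \<alpha> \<beta> (\<lambda>w. poly (sieved_jacobi_P N \<alpha> \<beta> n) (w + inverse w)) z
        = of_real (Lambda N \<alpha> \<beta> n) * poly (sieved_jacobi_P N \<alpha> \<beta> n) (z + inverse z)
    \<and> H_tilde_op N q \<alpha> \<beta> (\<lambda>w. poly (sieved_jacobi_Q N \<alpha> \<beta> n) (w + inverse w)) z
        = of_real (Lambda N \<alpha> \<beta> (n + 1)) * poly (sieved_jacobi_Q N \<alpha> \<beta> n) (z + inverse z)"
proof (intro allI ballI conjI)
  fix n z assume z: "z \<in> regular_points N q"
  note nz = regular_pointsD(1)[OF assms(2,1)]
  show "H_op N q \<alpha> \<beta> (\<lambda>w. poly (sieved_jacobi_P N \<alpha> \<beta> n) (w + inverse w)) z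
        = of_real (Lambda N \<alpha> \<beta> n) * poly (sieved_jacobi_P N \<alpha> \<beta> n) (z + inverse z)"
  proof (cases n)
    case 0
    have "L_op N q \<alpha> \<beta> (\<lambda>w. c) = (\<lambda>w. 0)" for c
      by (simp add: L_op_def refl_op_def fun_eq_iff)
    with 0 show ?thesis by (simp add: sieved_jacobi_P_def H_op_def Lambda_def)
  next
    case (Suc m)
    have eq: "poly (sieved_jacobi_P N \<alpha> \<beta> n) (w + inverse w) =
        cmv_odd N \<alpha> \<beta> m w + 1 * cmv_odd N \<alpha> \<beta> m (inverse w)" if "w \<in> regular_points N q" for w
      using sieved_jacobi_P_eq[OF nz[OF that]] Suc by simp
    have "H_op N q \<alpha> \<beta> (\<lambda>w. poly (sieved_jacobi_P N \<alpha> \<beta> n) (w + inverse w)) z =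
        H_op N q \<alpha> \<beta> (\<lambda>w. cmv_odd N \<alpha> \<beta> m w + 1 * cmv_odd N \<alpha> \<beta> m (inverse w)) z"
      by (rule H_op_cong[OF assms(2,1) z eq])
    also have "\<dots> = of_real (Lambda N \<alpha> \<beta> n) *
        (cmv_odd N \<alpha> \<beta> m z + 1 * cmv_odd N \<alpha> \<beta> m (inverse z))"
      unfolding Suc by (rule H_op_cmv_odd_reflect[OF assms(2,1,3,4) z])
    finally show ?thesis unfolding eq[OF z] .
  qed
  have phi_nz: "phi w \<noteq> 0" if "w \<in> regular_points N q" for w
    using regular_pointsD(2)[OF assms(2,1) that, of 0] nz[OF that]
    by (auto simp: phi_def field_simps power2_eq_square)
  have eq: "phi w * poly (sieved_jacobi_Q N \<alpha> \<beta> n) (w + inverse w) =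
      cmv_odd N \<alpha> \<beta> n w + (-1) * cmv_odd N \<alpha> \<beta> n (inverse w)" if "w \<in> regular_points N q" for w
    using sieved_jacobi_Q_eq[OF nz[OF that]] phi_nz[OF that] by (simp add: phi_def)
  have "H_op N q \<alpha> \<beta> (\<lambda>w. phi w * poly (sieved_jacobi_Q N \<alpha> \<beta> n) (w + inverse w)) z =
      H_op N q \<alpha> \<beta> (\<lambda>w. cmv_odd N \<alpha> \<beta> n w + (-1) * cmv_odd N \<alpha> \<beta> n (inverse w)) z"
    by (rule H_op_cong[OF assms(2,1) z eq])
  also have "\<dots> = of_real (Lambda N \<alpha> \<beta> (n + 1)) *
      (cmv_odd N \<alpha> \<beta> n z + (-1) * cmv_odd N \<alpha> \<beta> n (inverse z))"
    unfolding Suc_eq_plus1[symmetric] by (rule H_op_cmv_odd_reflect[OF assms(2,1,3,4) z])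
  finally show "H_tilde_op N q \<alpha> \<beta> (\<lambda>w. poly (sieved_jacobi_Q N \<alpha> \<beta> n) (w + inverse w)) z
        = of_real (Lambda N \<alpha> \<beta> (n + 1)) * poly (sieved_jacobi_Q N \<alpha> \<beta> n) (z + inverse z)"
    unfolding H_tilde_op_def eq[OF z, symmetric] using phi_nz[OF z] by simp
qed

end
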